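(* Let $G$ be an $n$-vertex graph of twin-width $d$, and let $X \subseteq V(G)$ with $X \neq \emptyset$. Then the number of distinct $X$-neighbourhoods in $G$, that is, $|\{N_G(v)\cap X \mid v \in V(G)\}|$, is at most $(d+2)2^{d+1}|X|$ (and, for $d \geqslant 1$, $(d+2)2^{d+1}|X| = 2^{d+\log d+\Theta(1)}|X|$).
   Context: Graphs are finite, simple and undirected. $N_G(v)$ denotes the (open) neighbourhood of $v$ in $G$. For $X \subseteq V(G)$, an $X$-neighbourhood is a set $N_G(v) \cap X$ for some $v \in V(G)$ (vertices $v\in X$ are allowed). The logarithm is in base 2, and $\Theta(1)$ in the exponent denotes a quantity bounded in absolute value by an absolute constant. Trigraphs: a trigraph is a triple $G=(V(G),E(G),R(G))$ where $E(G)$ and $R(G)$ are disjoint sets of edges (unordered pairs of distinct vertices) on $V(G)$, called black edges and red edges respectively. The red degree of a trigraph is the maximum degree of the graph $(V(G),R(G))$. Any graph $G$ is viewed as the trigraph $(V(G),E(G),\emptyset)$. Contraction: given a trigraph $G$ and two distinct vertices $u,v \in V(G)$ (not necessarily adjacent), the contraction $G' = G/u,v$ is the trigraph with vertex set $V(G') = \{w\} \cup (V(G)\setminus\{u,v\})$, where $w$ is a new vertex, such that the (black and red) edges between vertices of $V(G)\setminus\{u,v\}$ are the same as in $G$, and for each $x \in V(G)\setminus\{u,v\}$: $wx \in E(G')$ if $xu \in E(G)$ and $xv \in E(G)$; $wx \notin E(G')\cup R(G')$ if $xu \notin E(G)\cup R(G)$ and $xv \notin E(G)\cup R(G)$; and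 $wx \in R(G')$ otherwise. Twin-width: a $d$-sequence of an $n$-vertex graph $G$ is a sequence of $n$ trigraphs $G=G_n, G_{n-1},\ldots,G_1$ such that each $G_i$ with $i<n$ is obtained from $G_{i+1}$ by a contraction, and each $G_i$ has red degree at most $d$. The twin-width of $G$ is the minimum integer $d$ such that $G$ admits a $d$-sequence. *)

theory Defs
  imports Complex_Main
begin

record 'a sgraph =
  verts :: "'a set"
  edges :: "'a set set"

definition finite_simple_graph :: "'a sgraph \<Rightarrow> bool" where
  "finite_simple_graph G \<longleftrightarrow> finite (verts G) \<and>
     (\<forall>e\<in>edges G. \<exists>u\<in>verts G. \<exists>v\<in>verts G. u \<noteq> v \<and> e = {u, v})"

definition neighbourhood :: "'a sgraph \<Rightarrow> 'a \<Rightarrow> 'a set" where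
  "neighbourhood G v = {u \<in> verts G. {u, v} \<in> edges G}"

definition X_neighbourhoods :: "'a sgraph \<Rightarrow> 'a set \<Rightarrow> 'a set set" where
  "X_neighbourhoods G X = {neighbourhood G v \<inter> X | v. v \<in> verts G}"

record 'a trigraph =
  tverts :: "'a set"
  black :: "'a set set"
  red :: "'a set set"

definition is_trigraph :: "'a trigraph \<Rightarrow> bool" where
  "is_trigraph T \<longleftrightarrow> finite (tverts T) \<and> black T \<inter> red T = {} \<and>
     (\<forall>e\<in>black T \<union> red T. \<exists>u\<in>tverts T. \<exists>v\<in>tverts T. u \<noteq> v \<and> e = {u, v})"

definition trigraph_of :: "'a sgraph \<Rightarrow> 'a trigraph" where
  "trigraph_of G = \<lparr>tverts = verts G, black = edges G, red = {}\<rparr>"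

text \<open>For trigraphs with at least one vertex; \<^term>\<open>Max {}\<close> is unspecified.\<close>

definition red_degree :: "'a trigraph \<Rightarrow> nat" where
  "red_degree T = Max ((\<lambda>v. card {u \<in> tverts T. {u, v} \<in> red T}) ` tverts T)"

definition contract :: "'a trigraph \<Rightarrow> 'a \<Rightarrow> 'a \<Rightarrow> 'a \<Rightarrow> 'a trigraph" where
  "contract T u v w =
    (let V = tverts T - {u, v}; B = black T; A = black T \<union> red T in
     \<lparr>tverts = insert w V,
      black = {e \<in> B. e \<subseteq> V} \<union>
        {{w, x} | x. x \<in> V \<and> {x, u} \<in> B \<and> {x, v} \<in> B},
      red = {e \<in> red T. e \<subseteq> V} \<union>
        {{w, x} | x. x \<in> V \<and> \<not> ({x, u} \<in> B \<and> {x, v} \<in> B) \<and>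
                    \<not> ({x, u} \<notin> A \<and> {x, v} \<notin> A)}\<rparr>)"

text \<open>The new vertex \<open>w\<close> only has to differ from the vertices that survive the contraction.
  It may reuse the name \<open>u\<close> or \<open>v\<close>: demanding \<open>w \<notin> tverts T\<close> would leave no
  contraction at all when \<open>tverts T\<close> exhausts a finite vertex type.\<close>

definition is_contraction :: "'a trigraph \<Rightarrow> 'a trigraph \<Rightarrow> bool" where
  "is_contraction T T' \<longleftrightarrow>
    (\<exists>u\<in>tverts T. \<exists>v\<in>tverts T. \<exists>w. u \<noteq> v \<and> w \<notin> tverts T - {u, v} \<and> T' = contract T u v w)"

lemma is_trigraph_trigraph_of:
  "finite_simple_graph G \<Longrightarrow> is_trigraph (trigraph_of G)"
  by (simp add: finite_simple_graph_def is_trigraph_def trigraph_of_def)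

lemma is_trigraph_contraction:
  assumes "is_trigraph T" "is_contraction T T'"
  shows "is_trigraph T'"
proof -
  obtain u v w where w: "w \<notin> tverts T - {u, v}" and T': "T' = contract T u v w"
    using assms(2) by (auto simp: is_contraction_def)
  have fin: "finite (tverts T)" and disj: "black T \<inter> red T = {}"
    and pairs: "\<And>e. e \<in> black T \<union> red T \<Longrightarrow>
      \<exists>a\<in>tverts T. \<exists>b\<in>tverts T. a \<noteq> b \<and> e = {a, b}"
    using assms(1) by (auto simp: is_trigraph_def)
  have "black T' \<inter> red T' = {}"
    using disj w by (auto simp: T' contract_def Let_def doubleton_eq_iff)
  moreover have "\<exists>a\<in>tverts T'. \<exists>b\<in>tverts T'. a \<noteq> b \<and> e = {a, b}"
    if "e \<in> black T' \<union> red T'" for e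
  proof -
    from that consider (old) "e \<in> black T \<union> red T" "e \<subseteq> tverts T - {u, v}"
      | (new) x where "x \<in> tverts T - {u, v}" "e = {w, x}"
      by (auto simp: T' contract_def Let_def)
    then show ?thesis
    proof cases
      case old
      obtain a b where "a \<noteq> b" "e = {a, b}"
        using pairs[OF old(1)] by blast
      then show ?thesis
        using old(2) by (auto simp: T' contract_def Let_def)
    next
      case new
      then have "w \<noteq> x" "w \<in> tverts T'" "x \<in> tverts T'"
        using w by (auto simp: T' contract_def Let_def)
      then show ?thesis
        using new(2) by blast
    qed
  qed
  moreover have "finite (tverts T')"
    using fin by (simp add: T' contract_def Let_def)
  ultimately show ?thesis
    by (simp add: is_trigraph_def)
qed

text \<open>The sequence \<open>G\<^sub>n, \<dots>, G\<^sub>1\<close> is the family \<open>S\<close> restricted to the indices \<open>1..n\<close>.\<close>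

definition is_d_sequence :: "nat \<Rightarrow> 'a sgraph \<Rightarrow> (nat \<Rightarrow> 'a trigraph) \<Rightarrow> bool" where
  "is_d_sequence d G S \<longleftrightarrow>
    (let n = card (verts G) in
     S n = trigraph_of G \<and>
     (\<forall>i\<in>{1..<n}. is_contraction (S (Suc i)) (S i)) \<and>
     (\<forall>i\<in>{1..n}. red_degree (S i) \<le> d))"

definition twin_width :: "'a sgraph \<Rightarrow> nat" where
  "twin_width G = (LEAST d. \<exists>S. is_d_sequence d G S)"

end

theory Submission
  imports Defs
begin

text \<open>
  The bound follows by deleting the vertices of \<open>X\<close> one at a time, in an order dictated by a
  \<open>d\<close>-sequence.  Each trigraph of the sequence is a quotient of \<open>G\<close>: its vertices are the
  parts of a partition of \<open>V(G)\<close>, and two parts not joined by a red edge are completely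
  adjacent or completely non-adjacent in \<open>G\<close>.  If \<open>X\<close> has at least two vertices, stop at the
  first trigraph in which two of them, say \<open>x\<close> and \<open>y\<close>, share a part \<open>P\<close>; at that moment every
  other part holds at most one vertex of \<open>X\<close>, so that the vertices of \<open>X - {x}\<close> lie in
  distinct parts (\<open>first_collision\<close>).

  Deleting \<open>x\<close> from \<open>X\<close> is injective on the neighbourhoods that do not separate \<open>x\<close> from \<open>y\<close>,
  since these remember \<open>x\<close> through \<open>y\<close>.  Hence the deletion loses at most as many
  neighbourhoods as there are \<open>X\<close>-neighbourhoods separating \<open>x\<close> from \<open>y\<close>
  (\<open>card_le_delete_plus_separating\<close>).  A vertex with such a neighbourhood lies in \<open>P\<close> or in one
  of the at most \<open>d\<close> red neighbours of \<open>P\<close>.  Inside one part \<open>Q\<close>, the neighbourhoods can only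
  vary on the vertices of \<open>X\<close> lying in \<open>Q\<close> or in a red neighbour of \<open>Q\<close>; apart from \<open>x\<close> these
  are at most \<open>d + 1\<close> vertices, and the membership of \<open>x\<close> is the opposite of that of \<open>y\<close>.
  So each of the at most \<open>d + 1\<close> parts contributes at most \<open>2 ^ (d + 1)\<close> separating
  neighbourhoods, and deleting \<open>x\<close> loses at most \<open>(d + 1) * 2 ^ (d + 1)\<close> of them
  (\<open>card_separating_le\<close>).
\<close>

section \<open>Trigraphs as quotients of a graph\<close>

text \<open>The fibres of \<open>\<phi>\<close> are the parts.  Nothing is required of a red edge: red means that the
  adjacency between the two parts is unknown.\<close>

definition quotient_map :: "'a sgraph \<Rightarrow> 'a trigraph \<Rightarrow> ('a \<Rightarrow> 'a) \<Rightarrow> bool" where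
  "quotient_map G T \<phi> \<longleftrightarrow> \<phi> ` verts G = tverts T \<and>
     (\<forall>a\<in>verts G. \<forall>b\<in>verts G. \<phi> a \<noteq> \<phi> b \<longrightarrow>
        ({\<phi> a, \<phi> b} \<in> black T \<longrightarrow> {a, b} \<in> edges G) \<and>
        ({\<phi> a, \<phi> b} \<notin> black T \<union> red T \<longrightarrow> {a, b} \<notin> edges G))"

definition red_nbhd :: "'a trigraph \<Rightarrow> 'a \<Rightarrow> 'a set" where
  "red_nbhd T p = {q \<in> tverts T. {q, p} \<in> red T}"

lemma card_red_nbhd_le:
  assumes "finite (tverts T)" "p \<in> tverts T"
  shows "card (red_nbhd T p) \<le> red_degree T"
  using assms unfolding red_degree_def red_nbhd_def by (intro Max_ge) auto

lemma quotient_map_id: "quotient_map G (trigraph_of G) (\<lambda>a. a)"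
  by (auto simp: quotient_map_def trigraph_of_def)

lemma quotient_map_homogeneous:
  assumes "quotient_map G T \<phi>" "a \<in> verts G" "b \<in> verts G" "z \<in> verts G"
    and "\<phi> a = \<phi> b" "\<phi> z \<noteq> \<phi> a" "\<phi> z \<notin> red_nbhd T (\<phi> a)"
  shows "{z, a} \<in> edges G \<longleftrightarrow> {z, b} \<in> edges G"
proof -
  have "{\<phi> z, \<phi> a} \<notin> red T"
    using assms by (auto simp: quotient_map_def red_nbhd_def)
  then show ?thesis
    using assms unfolding quotient_map_def by (metis Un_iff)
qed

lemma quotient_map_contract:
  assumes q: "quotient_map G T \<phi>"
    and uv: "u \<in> tverts T" "v \<in> tverts T"
    and w: "w \<notin> tverts T - {u, v}"
  shows "quotient_map G (contract T u v w) (\<lambda>a. if \<phi> a \<in> {u, v} then w else \<phi> a)"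
    (is "quotient_map G ?T' ?\<psi>")
proof -
  let ?V = "tverts T - {u, v}"
  let ?B = "black T" and ?A = "black T \<union> red T"
  have img: "\<phi> ` verts G = tverts T"
    using q by (simp add: quotient_map_def)
  have black_old: "{p, r} \<in> black ?T' \<longleftrightarrow> {p, r} \<in> ?B"
    and any_old: "{p, r} \<in> black ?T' \<union> red ?T' \<longleftrightarrow> {p, r} \<in> ?A"
    if "p \<in> ?V" "r \<in> ?V" for p r
    using that w by (auto simp: contract_def Let_def doubleton_eq_iff)
  have black_new: "{w, p} \<in> black ?T' \<longleftrightarrow> {p, u} \<in> ?B \<and> {p, v} \<in> ?B"
    and any_new: "{w, p} \<in> black ?T' \<union> red ?T' \<longleftrightarrow> {p, u} \<in> ?A \<or> {p, v} \<in> ?A"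
    if "p \<in> ?V" for p
    using that w by (auto simp: contract_def Let_def doubleton_eq_iff)
  have edge: "({p, r} \<in> ?B \<longrightarrow> {a, b} \<in> edges G) \<and> ({p, r} \<notin> ?A \<longrightarrow> {a, b} \<notin> edges G)"
    if "a \<in> verts G" "b \<in> verts G" "p = \<phi> a" "r = \<phi> b" "p \<noteq> r" for a b p r
    using q that unfolding quotient_map_def by blast
  have new: "({w, \<phi> b} \<in> black ?T' \<longrightarrow> {a, b} \<in> edges G) \<and>
      ({w, \<phi> b} \<notin> black ?T' \<union> red ?T' \<longrightarrow> {a, b} \<notin> edges G)"
    if "a \<in> verts G" "b \<in> verts G" "\<phi> a \<in> {u, v}" "\<phi> b \<notin> {u, v}" for a b
  proof -
    have b: "\<phi> b \<in> ?V"
      using that img by auto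
    have ne: "\<phi> a \<noteq> \<phi> b"
      using that by auto
    show ?thesis
      unfolding black_new[OF b] any_new[OF b]
      using edge[OF that(1,2) refl refl ne] that(3) by (auto simp: insert_commute)
  qed
  have "({?\<psi> a, ?\<psi> b} \<in> black ?T' \<longrightarrow> {a, b} \<in> edges G) \<and>
      ({?\<psi> a, ?\<psi> b} \<notin> black ?T' \<union> red ?T' \<longrightarrow> {a, b} \<notin> edges G)"
    if ab: "a \<in> verts G" "b \<in> verts G" and ne: "?\<psi> a \<noteq> ?\<psi> b" for a b
  proof -
    consider "\<phi> a \<in> {u, v}" "\<phi> b \<notin> {u, v}" | "\<phi> a \<notin> {u, v}" "\<phi> b \<in> {u, v}"
      | "\<phi> a \<notin> {u, v}" "\<phi> b \<notin> {u, v}"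
      using ne by fastforce
    then show ?thesis
    proof cases
      case 1
      then show ?thesis using new[OF ab] by simp
    next
      case 2
      then show ?thesis
        using new[OF ab(2,1)] by (simp add: insert_commute)
    next
      case 3
      then have V: "\<phi> a \<in> ?V" "\<phi> b \<in> ?V" and ne': "\<phi> a \<noteq> \<phi> b"
        using ab img ne by auto
      have "?\<psi> a = \<phi> a" "?\<psi> b = \<phi> b"
        using 3 by auto
      then show ?thesis
        using black_old[OF V] any_old[OF V] edge[OF ab refl refl ne'] by simp
    qed
  qed
  moreover have "?\<psi> ` verts G = tverts ?T'"
  proof -
    have "?\<psi> ` verts G = (\<lambda>p. if p \<in> {u, v} then w else p) ` tverts T"
      unfolding img[symmetric] image_image ..
    also have "\<dots> = tverts ?T'"
      using uv by (auto simp: contract_def Let_def image_iff)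
    finally show ?thesis .
  qed
  ultimately show ?thesis
    unfolding quotient_map_def by blast
qed

section \<open>Contraction sequences\<close>

lemma card_tverts_contract:
  assumes "finite (tverts T)" "u \<in> tverts T" "v \<in> tverts T" "u \<noteq> v" "w \<notin> tverts T - {u, v}"
  shows "card (tverts T) = Suc (card (tverts (contract T u v w)))"
proof -
  have "tverts T = insert u (insert v (tverts T - {u, v}))"
    using assms by auto
  then have "card (tverts T) = Suc (Suc (card (tverts T - {u, v})))"
    using assms by (metis Diff_iff card_insert_disjoint finite_Diff finite_insert insert_iff)
  then show ?thesis
    using assms by (simp add: contract_def Let_def)
qed

lemma exists_contraction_sequence:
  assumes "card (tverts T) = n" "n \<ge> 1"
  shows "\<exists>S. S n = T \<and> (\<forall>i\<in>{1..<n}. is_contraction (S (Suc i)) (S i))"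
  using assms
proof (induction n arbitrary: T)
  case 0
  then show ?case by simp
next
  case (Suc n)
  show ?case
  proof (cases "n = 0")
    case True
    then show ?thesis by auto
  next
    case False
    have fin: "finite (tverts T)"
      using Suc.prems by (metis card.infinite nat.distinct(1))
    obtain u v where uv: "u \<in> tverts T" "v \<in> tverts T" "u \<noteq> v"
    proof -
      have "\<not> card (tverts T) \<le> Suc 0"
        using Suc.prems False by simp
      then show thesis
        using that fin card_le_Suc0_iff_eq by metis
    qed
    have "card (tverts (contract T u v u)) = n"
      using card_tverts_contract[OF fin uv, of u] Suc.prems by simp
    then obtain S where S: "S n = contract T u v u"
      "\<forall>i\<in>{1..<n}. is_contraction (S (Suc i)) (S i)"
      using Suc.IH False by (metis One_nat_def Suc_leI neq0_conv)
    have "is_contraction T (S n)"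
      unfolding is_contraction_def S(1) using uv by blast
    then have "is_contraction ((S(Suc n := T)) (Suc i)) ((S(Suc n := T)) i)"
      if "i \<in> {1..<Suc n}" for i
      using that S(2) by (cases "i = n") auto
    then show ?thesis
      by (intro exI[of _ "S(Suc n := T)"]) auto
  qed
qed

text \<open>\<^const>\<open>twin_width\<close> is a \<open>LEAST\<close>, so it is attained only because some sequence exists at all;
  any contraction sequence is a \<open>d\<close>-sequence for large enough \<open>d\<close>.\<close>

lemma twin_width_attained:
  assumes "finite_simple_graph G" "verts G \<noteq> {}"
  shows "\<exists>S. is_d_sequence (twin_width G) G S"
proof -
  let ?n = "card (verts G)"
  have "?n \<ge> 1"
    using assms by (simp add: finite_simple_graph_def Suc_le_eq card_gt_0_iff)
  then obtain S where S: "S ?n = trigraph_of G"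
    "\<forall>i\<in>{1..<?n}. is_contraction (S (Suc i)) (S i)"
    using exists_contraction_sequence[of "trigraph_of G" ?n] by (auto simp: trigraph_of_def)
  have "is_d_sequence (Max ((\<lambda>i. red_degree (S i)) ` {1..?n})) G S"
    using S by (auto simp: is_d_sequence_def Let_def)
  then show ?thesis
    unfolding twin_width_def by (intro LeastI[where P = "\<lambda>d. \<exists>S. is_d_sequence d G S"] exI)
qed

text \<open>Follow the parts along the sequence for as long as they separate the vertices of \<open>X\<close>.  They
  cannot do so until the end, where a single part is left; and the contraction that first breaks
  this merges two parts with one vertex of \<open>X\<close> each, so forgetting one of the two restores
  injectivity.\<close>

lemma first_collision:
  assumes seq: "is_d_sequence d G S" and fin: "finite (verts G)"
    and X: "X \<subseteq> verts G" and card_X: "card X \<ge> 2"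
  obtains i \<phi> x y where "i \<in> {1..card (verts G)}" "quotient_map G (S i) \<phi>"
    "x \<in> X" "y \<in> X" "x \<noteq> y" "\<phi> x = \<phi> y" "inj_on \<phi> (X - {x})"
proof -
  let ?n = "card (verts G)"
  define collision where "collision \<longleftrightarrow> (\<exists>i \<phi> x y. i \<in> {1..?n} \<and> quotient_map G (S i) \<phi> \<and>
      x \<in> X \<and> y \<in> X \<and> x \<noteq> y \<and> \<phi> x = \<phi> y \<and> inj_on \<phi> (X - {x}))"
  have Sn: "S ?n = trigraph_of G"
    and step: "\<And>i. i \<in> {1..<?n} \<Longrightarrow> is_contraction (S (Suc i)) (S i)"
    using seq by (auto simp: is_d_sequence_def Let_def)
  have n: "?n \<ge> 1"
    using card_mono[OF fin X] card_X by simp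
  have "collision \<or> (card (tverts (S 1)) = 1 \<and> (\<exists>\<phi>. quotient_map G (S 1) \<phi> \<and> inj_on \<phi> X))"
    using n
  proof (induction rule: inc_induct)
    case base
    have "quotient_map G (S ?n) (\<lambda>a. a)"
      using quotient_map_id Sn by simp
    then show ?case
      using Sn by (auto simp: trigraph_of_def)
  next
    case (step i)
    show ?case
    proof (cases collision)
      case False
      then obtain \<phi> where card_i: "card (tverts (S (Suc i))) = Suc i"
        and \<phi>: "quotient_map G (S (Suc i)) \<phi>" "inj_on \<phi> X"
        using step.IH by auto
      obtain u v w where uvw: "u \<in> tverts (S (Suc i))" "v \<in> tverts (S (Suc i))" "u \<noteq> v"
        "w \<notin> tverts (S (Suc i)) - {u, v}" and Si: "S i = contract (S (Suc i)) u v w"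
        using \<open>\<And>i. i \<in> {1..<?n} \<Longrightarrow> is_contraction (S (Suc i)) (S i)\<close>[of i] step.hyps
        unfolding is_contraction_def by auto
      define \<psi> where "\<psi> = (\<lambda>a. if \<phi> a \<in> {u, v} then w else \<phi> a)"
      have \<psi>: "quotient_map G (S i) \<psi>"
        unfolding \<psi>_def Si by (rule quotient_map_contract[OF \<phi>(1) uvw(1,2,4)])
      have "inj_on \<psi> X"
      proof (rule ccontr)
        assume "\<not> inj_on \<psi> X"
        then obtain x y where xy: "x \<in> X" "y \<in> X" "x \<noteq> y" "\<psi> x = \<psi> y"
          by (auto simp: inj_on_def)
        have part: "\<phi> z \<in> tverts (S (Suc i))" if "z \<in> X" for z
          using that X \<phi>(1) by (auto simp: quotient_map_def)
        have merged: "\<phi> a \<in> {u, v} \<and> \<phi> b \<in> {u, v}"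
          if "a \<in> X" "b \<in> X" "a \<noteq> b" "\<psi> a = \<psi> b" for a b
          using that part[of a] part[of b] \<phi>(2) uvw(4)
          by (auto simp: \<psi>_def inj_on_def split: if_splits)
        have "inj_on \<psi> (X - {x})"
        proof (rule inj_onI, rule ccontr)
          fix a b assume ab: "a \<in> X - {x}" "b \<in> X - {x}" "\<psi> a = \<psi> b" "a \<noteq> b"
          then have "\<phi> a \<in> {u, v}" "\<phi> b \<in> {u, v}" "\<phi> x \<in> {u, v}"
            using merged[of a b] merged[of x y] xy by auto
          moreover have "\<phi> a \<noteq> \<phi> b" "\<phi> a \<noteq> \<phi> x" "\<phi> b \<noteq> \<phi> x"
            using ab xy \<phi>(2) by (auto simp: inj_on_def)
          ultimately show False by auto
        qed
        moreover have "i \<in> {1..?n}"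
          using step.hyps by auto
        ultimately have collision
          unfolding collision_def using xy \<psi> by blast
        then show False using False by simp
      qed
      moreover have "card (tverts (S i)) = i"
      proof -
        have "finite (tverts (S (Suc i)))"
          using card_i by (metis card.infinite nat.distinct(1))
        from card_tverts_contract[OF this uvw] show ?thesis
          using card_i Si by simp
      qed
      ultimately show ?thesis using \<psi> by blast
    qed simp
  qed
  moreover have "\<not> inj_on \<phi> X" if "card (tverts (S 1)) = 1" "quotient_map G (S 1) \<phi>" for \<phi>
  proof
    assume "inj_on \<phi> X"
    then have "card X \<le> card (tverts (S 1))"
      using that X fin
      by (metis card_inj_on_le finite_imageI image_mono quotient_map_def)
    then show False using that card_X by simp
  qed
  ultimately have collision by blast
  then show thesis
    unfolding collision_def using that by blast
qed

section \<open>Deleting one vertex\<close>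

lemma finite_X_neighbourhoods: "finite (verts G) \<Longrightarrow> finite (X_neighbourhoods G X)"
  by (simp add: X_neighbourhoods_def Setcompr_eq_image)

lemma card_le_delete_plus_separating:
  assumes "finite F" "x \<noteq> y"
  shows "card F \<le> card ((\<lambda>A. A - {x}) ` F) + card {A \<in> F. x \<in> A \<longleftrightarrow> y \<notin> A}"
proof -
  let ?N = "{A \<in> F. x \<in> A \<longleftrightarrow> y \<in> A}" and ?S = "{A \<in> F. x \<in> A \<longleftrightarrow> y \<notin> A}"
  have "inj_on (\<lambda>A. A - {x}) ?N"
  proof (rule inj_onI)
    fix A B assume A: "A \<in> ?N" and B: "B \<in> ?N" and eq: "A - {x} = B - {x}"
    then have "x \<in> A \<longleftrightarrow> x \<in> B"
      using assms(2) by blast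
    then show "A = B" using eq by blast
  qed
  then have "card ?N \<le> card ((\<lambda>A. A - {x}) ` F)"
    using assms(1) by (intro card_inj_on_le[where f = "\<lambda>A. A - {x}"]) auto
  moreover have "card F \<le> card ?N + card ?S"
  proof -
    have "F = ?N \<union> ?S" by blast
    then show ?thesis
      using card_Un_le[of ?N ?S] by argo
  qed
  ultimately show ?thesis by simp
qed

lemma X_neighbourhoods_delete:
  "(\<lambda>A. A - {x}) ` X_neighbourhoods G X = X_neighbourhoods G (X - {x})"
  by (auto simp: X_neighbourhoods_def image_iff)

text \<open>Within one part the neighbourhoods agree outside the red neighbours of the part and the part
  itself, and \<open>x\<close> is decided by \<open>y\<close>; so they are determined by their traces on a set that
  \<open>\<phi>\<close> embeds into these at most \<open>d + 1\<close> parts.\<close>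

lemma card_separating_in_part_le:
  assumes q: "quotient_map G T \<phi>" and fin: "finite (verts G)" and X: "X \<subseteq> verts G"
    and deg: "red_degree T \<le> d" and p: "p \<in> tverts T"
    and xy: "x \<noteq> y" and inj: "inj_on \<phi> (X - {x})"
  shows "card {neighbourhood G a \<inter> X | a. a \<in> verts G \<and> \<phi> a = p \<and>
      (x \<in> neighbourhood G a \<inter> X \<longleftrightarrow> y \<notin> neighbourhood G a \<inter> X)} \<le> 2 ^ (d + 1)"
    (is "card ?F \<le> _")
proof -
  let ?P = "insert p (red_nbhd T p)"
  define Z where "Z = {z \<in> X - {x}. \<phi> z \<in> ?P}"
  have finT: "finite (tverts T)"
    using q fin by (metis finite_imageI quotient_map_def)
  then have finP: "finite ?P"
    by (simp add: red_nbhd_def)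
  have finZ: "finite Z"
    using finite_subset[OF X fin] by (simp add: Z_def)
  have "card Z \<le> card ?P"
    using inj by (intro card_inj_on_le[OF _ _ finP, of \<phi>]) (auto simp: Z_def inj_on_def)
  also have "\<dots> \<le> Suc (card (red_nbhd T p))"
    by (rule card_insert_le_m1) simp_all
  also have "\<dots> \<le> d + 1"
    using card_red_nbhd_le[OF finT p] deg by simp
  finally have Z: "card Z \<le> d + 1" .
  have "inj_on (\<lambda>A. A \<inter> Z) ?F"
  proof (rule inj_onI)
    fix A B assume A: "A \<in> ?F" and B: "B \<in> ?F" and eq: "A \<inter> Z = B \<inter> Z"
    obtain a where a: "a \<in> verts G" "\<phi> a = p" "A = neighbourhood G a \<inter> X"
      and sepA: "x \<in> A \<longleftrightarrow> y \<notin> A"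
      using A by auto
    obtain b where b: "b \<in> verts G" "\<phi> b = p" "B = neighbourhood G b \<inter> X"
      and sepB: "x \<in> B \<longleftrightarrow> y \<notin> B"
      using B by auto
    have agree: "z \<in> A \<longleftrightarrow> z \<in> B" if "z \<noteq> x" for z
    proof (cases "z \<in> X \<and> z \<notin> Z")
      case True
      then have "\<phi> z \<noteq> p" "\<phi> z \<notin> red_nbhd T p" "z \<in> verts G"
        using that X by (auto simp: Z_def)
      then show ?thesis
        using quotient_map_homogeneous[OF q a(1) b(1)] a b by (auto simp: neighbourhood_def)
    next
      case False
      then show ?thesis using eq a(3) b(3) by blast
    qed
    then have "x \<in> A \<longleftrightarrow> x \<in> B"
      using agree[of y] sepA sepB xy by simp
    then show "A = B" using agree by (intro set_eqI) metis
  qed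
  then have "card ?F \<le> card (Pow Z)"
    by (rule card_inj_on_le) (use finZ in auto)
  also have "\<dots> \<le> 2 ^ (d + 1)"
    using Z by (simp add: card_Pow finZ del: power_Suc)
  finally show ?thesis .
qed

text \<open>A vertex outside the common part of \<open>x\<close> and \<open>y\<close> and outside its red neighbours is adjacent
  to both or to neither, so at most \<open>d + 1\<close> parts contribute.\<close>

lemma card_separating_le:
  assumes q: "quotient_map G T \<phi>" and fin: "finite (verts G)" and X: "X \<subseteq> verts G"
    and deg: "red_degree T \<le> d"
    and xy: "x \<in> X" "y \<in> X" "x \<noteq> y" "\<phi> x = \<phi> y" and inj: "inj_on \<phi> (X - {x})"
  shows "card {A \<in> X_neighbourhoods G X. x \<in> A \<longleftrightarrow> y \<notin> A} \<le> (d + 1) * 2 ^ (d + 1)"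
    (is "card ?S \<le> _")
proof -
  let ?P = "insert (\<phi> x) (red_nbhd T (\<phi> x))"
  let ?F = "\<lambda>p. {neighbourhood G a \<inter> X | a. a \<in> verts G \<and> \<phi> a = p \<and>
      (x \<in> neighbourhood G a \<inter> X \<longleftrightarrow> y \<notin> neighbourhood G a \<inter> X)}"
  have img: "\<phi> ` verts G = tverts T"
    using q by (simp add: quotient_map_def)
  then have finT: "finite (tverts T)"
    using fin by (metis finite_imageI)
  have px: "\<phi> x \<in> tverts T"
    using img X xy by auto
  have P: "finite ?P" "?P \<subseteq> tverts T"
    using finT px by (auto simp: red_nbhd_def)
  have cardP: "card ?P \<le> d + 1"
  proof -
    have "card ?P \<le> Suc (card (red_nbhd T (\<phi> x)))"
      by (rule card_insert_le_m1) simp_all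
    then show ?thesis
      using card_red_nbhd_le[OF finT px] deg by simp
  qed
  have "?S \<subseteq> (\<Union>p\<in>?P. ?F p)"
  proof
    fix A assume "A \<in> ?S"
    then obtain a where a: "a \<in> verts G" "A = neighbourhood G a \<inter> X" and sep: "x \<in> A \<longleftrightarrow> y \<notin> A"
      by (auto simp: X_neighbourhoods_def)
    have "\<phi> a \<in> ?P"
    proof (rule ccontr)
      assume "\<phi> a \<notin> ?P"
      then have "{a, x} \<in> edges G \<longleftrightarrow> {a, y} \<in> edges G"
        using quotient_map_homogeneous[OF q _ _ a(1) xy(4)] X xy by auto
      then show False
        using sep a xy X by (auto simp: neighbourhood_def insert_commute)
    qed
    then show "A \<in> (\<Union>p\<in>?P. ?F p)"
      using a sep by blast
  qed
  moreover have "finite (\<Union>p\<in>?P. ?F p)"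
    by (rule finite_subset[OF _ finite_X_neighbourhoods[OF fin, of X]])
      (auto simp: X_neighbourhoods_def)
  ultimately have "card ?S \<le> card (\<Union>p\<in>?P. ?F p)"
    by (rule card_mono[rotated])
  also have "\<dots> \<le> (\<Sum>p\<in>?P. card (?F p))"
    by (rule card_UN_le[OF P(1)])
  also have "\<dots> \<le> card ?P * 2 ^ (d + 1)"
  proof (rule sum_bounded_above[where 'a = nat, simplified of_nat_id])
    show "card (?F p) \<le> 2 ^ (d + 1)" if "p \<in> ?P" for p
      using card_separating_in_part_le[OF q fin X deg _ xy(3) inj] that P(2) by blast
  qed
  also have "\<dots> \<le> (d + 1) * 2 ^ (d + 1)"
    using cardP by (intro mult_right_mono) auto
  finally show ?thesis .
qed

section \<open>Neighbourhood complexity\<close>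

lemma card_X_neighbourhoods_le:
  assumes seq: "is_d_sequence d G S" and fin: "finite (verts G)"
    and "X \<subseteq> verts G" "X \<noteq> {}"
  shows "card (X_neighbourhoods G X) \<le> (d + 1) * 2 ^ (d + 1) * card X"
proof -
  have "finite X"
    using assms finite_subset by blast
  then show ?thesis
    using assms(3,4)
  proof (induction "card X" arbitrary: X rule: less_induct)
    case less
    note X = less.prems
    show ?case
    proof (cases "card X \<ge> 2")
      case False
      then have cX: "card X = 1"
        using X by (simp add: not_le less_2_cases_iff)
      have "card (X_neighbourhoods G X) \<le> card (Pow X)"
        using X(1) by (intro card_mono) (auto simp: X_neighbourhoods_def)
      also have "\<dots> = 2"
        using cX X(1) by (simp add: card_Pow)
      also have "\<dots> \<le> (d + 1) * 2 ^ (d + 1) * card X"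
        using cX mult_le_mono[of 1 "d + 1" 2 "2 ^ (d + 1)"] by simp
      finally show ?thesis .
    next
      case True
      obtain i \<phi> x y where i: "i \<in> {1..card (verts G)}" and q: "quotient_map G (S i) \<phi>"
        and xy: "x \<in> X" "y \<in> X" "x \<noteq> y" "\<phi> x = \<phi> y" and inj: "inj_on \<phi> (X - {x})"
        using first_collision[OF seq fin X(2) True] by metis
      have deg: "red_degree (S i) \<le> d"
        using seq i by (auto simp: is_d_sequence_def Let_def)
      have cX: "card X = card (X - {x}) + 1"
        using X(1) xy(1) by (metis Suc_eq_plus1 card.remove)
      have "card (X_neighbourhoods G X) \<le> card (X_neighbourhoods G (X - {x})) +
          card {A \<in> X_neighbourhoods G X. x \<in> A \<longleftrightarrow> y \<notin> A}"
        using card_le_delete_plus_separating[OF finite_X_neighbourhoods[OF fin] xy(3)]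
        by (simp add: X_neighbourhoods_delete)
      also have "\<dots> \<le> (d + 1) * 2 ^ (d + 1) * card (X - {x}) + (d + 1) * 2 ^ (d + 1)"
      proof (rule add_mono)
        show "card (X_neighbourhoods G (X - {x})) \<le> (d + 1) * 2 ^ (d + 1) * card (X - {x})"
        proof (rule less.hyps)
          show "card (X - {x}) < card X"
            using cX by linarith
        qed (use X xy in auto)
      qed (rule card_separating_le[OF q fin X(2) deg xy inj])
      also have "\<dots> = (d + 1) * 2 ^ (d + 1) * card X"
        unfolding cX by (simp only: distrib_left mult_1_right)
      finally show ?thesis .
    qed
  qed
qed

text \<open>The exponent is off by \<open>\<theta> = 1 + log 2 ((k + 2) / k)\<close>, and \<open>1 \<le> (k + 2) / k \<le> 4\<close>.\<close>

lemma bound_asymptotics: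
  fixes k :: nat
  assumes "k \<ge> 1"
  shows "\<exists>\<theta>::real. \<bar>\<theta>\<bar> \<le> 3 \<and>
    (real k + 2) * 2 ^ (k + 1) = 2 powr (real k + log 2 (real k) + \<theta>)"
proof (intro exI conjI)
  let ?r = "(real k + 2) / real k"
  have k: "real k \<ge> 1"
    using assms by simp
  then have r: "1 \<le> ?r" "?r \<le> 4"
    by (simp_all add: field_simps)
  have "log 2 ?r \<le> log 2 (2 ^ 2)"
    using r by (subst log_le_cancel_iff) auto
  also have "log 2 (2 ^ 2) = (2::real)"
    by (subst log_nat_power) auto
  finally have "log 2 ?r \<le> 2" .
  moreover have "0 \<le> log 2 ?r"
    using r by (subst zero_le_log_cancel_iff) auto
  ultimately show "\<bar>1 + log 2 ?r\<bar> \<le> 3"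
    by simp
  have "2 powr (real k + log 2 (real k) + (1 + log 2 ?r)) = 2 ^ k * real k * (2 * ?r)"
    using k r by (simp add: powr_add powr_realpow)
  also have "\<dots> = (real k + 2) * 2 ^ (k + 1)"
    using k by simp
  finally show "(real k + 2) * 2 ^ (k + 1) = 2 powr (real k + log 2 (real k) + (1 + log 2 ?r))"
    by simp
qed

theorem theorem1:
  fixes G :: "'a sgraph" and X :: "'a set" and d :: nat
  assumes "finite_simple_graph G"
    and "twin_width G = d"
    and "X \<subseteq> verts G"
    and "X \<noteq> {}"
  shows "card (X_neighbourhoods G X) \<le> (d + 2) * 2 ^ (d + 1) * card X \<and>
    (\<exists>C::real. \<forall>k m :: nat. k \<ge> 1 \<longrightarrow>
      (\<exists>\<theta>::real. \<bar>\<theta>\<bar> \<le> C \<and>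
        (real k + 2) * 2 ^ (k + 1) * real m = 2 powr (real k + log 2 (real k) + \<theta>) * real m))"
proof
  have fin: "finite (verts G)"
    using assms(1) by (simp add: finite_simple_graph_def)
  obtain S where "is_d_sequence d G S"
    using twin_width_attained[OF assms(1)] assms by auto
  then have "card (X_neighbourhoods G X) \<le> (d + 1) * 2 ^ (d + 1) * card X"
    using card_X_neighbourhoods_le fin assms(3,4) by blast
  also have "\<dots> \<le> (d + 2) * 2 ^ (d + 1) * card X"
    by (intro mult_right_mono) auto
  finally show "card (X_neighbourhoods G X) \<le> (d + 2) * 2 ^ (d + 1) * card X" .
next
  show "\<exists>C::real. \<forall>k m :: nat. k \<ge> 1 \<longrightarrow>
      (\<exists>\<theta>::real. \<bar>\<theta>\<bar> \<le> C \<and>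
        (real k + 2) * 2 ^ (k + 1) * real m = 2 powr (real k + log 2 (real k) + \<theta>) * real m)"
    using bound_asymptotics by (intro exI[of _ 3]) metis
qed

end
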